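(* Let $M$ be an integral $P_l(\mathcal{O}_K)$-module and let $S$ be a standard submodule of $M$ of finite index. (a) Let $1 \leq i \leq l$. Then $L_i(S) = L_i(M) \cap S$, and $$\rho_i \colon Q_i(S) \to Q_i(M) : a + L_i(S) \mapsto a + L_i(M)$$ is injective with image $R_i(S)$ of finite index in $Q_i(M)$. (b) Write $[Q_i(M) : R_i(S)] = h_i$ for $1 \leq i \leq l$. Then $$[M:S] = \prod_{i=1}^l \prod_{j=i}^l h_j = \prod_{k=1}^l h_k^k.$$
   Context: Let $K$ be an algebraic number field with maximal order $\mathcal{O}_K$, let $l \in \mathbb{N}$ be positive, and let $P_l(\mathcal{O}_K) = \mathcal{O}_K[y]/(y^l)$. Modules are written with the action on the right. A $P_l(\mathcal{O}_K)$-module $M$ is integral if $M \cong \mathbb{Z}^n$ as abelian group for some $n \in \mathbb{N}$. For a $P_l(\mathcal{O}_K)$-module $M$ define $K_i(M) = \{ m \in M \mid m y^i = 0\}$ for $0 \leq i \leq l+1$, $L_i(M) = K_{i+1}(M)y + K_{i-1}(M)$ and $Q_i(M) = K_i(M)/L_i(M)$ for $1 \leq i \leq l$. The module $M$ is standard if it is integral and $Q_i(M)$ is free as $\mathcal{O}_K$-module for $1 \leq i \leq l$. A standard submodule of $M$ is a $P_l(\mathcal{O}_K)$-submodule that is standard as a $P_l(\mathcal{O}_K)$-module. *)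

theory Defs
  imports "HOL-Algebra.Algebra" "HOL-Algebra.Algebraic_Closure_Type"
begin

text \<open>
  A number field is given as a subset \<open>K\<close> of an arbitrary field type of characteristic 0 (for
  instance of \<^typ>\<open>complex\<close>, or as the universe of a type).
\<close>
definition number_field :: "'k::field_char_0 set \<Rightarrow> bool" where
  "number_field K \<longleftrightarrow>
     subfield K ring_of_type_algebra \<and> ring.finite_dimension ring_of_type_algebra \<rat> K"

text \<open>The maximal order of \<open>K\<close> is its ring of algebraic integers.\<close>
definition max_order :: "'k::field_char_0 set \<Rightarrow> 'k ring" where
  "max_order K = ring_of_type_algebra \<lparr>carrier := {x \<in> K. algebraic_int x}\<rparr>"

definition P_ideal :: "'k::field_char_0 set \<Rightarrow> nat \<Rightarrow> (nat \<Rightarrow> 'k) set" where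
  "P_ideal K l =
     PIdl\<^bsub>UP (max_order K)\<^esub> (up_ring.monom (UP (max_order K)) \<one>\<^bsub>max_order K\<^esub> l)"

definition P_ring :: "'k::field_char_0 set \<Rightarrow> nat \<Rightarrow> (nat \<Rightarrow> 'k) set ring" where
  "P_ring K l = UP (max_order K) Quot P_ideal K l"

definition P_y :: "'k::field_char_0 set \<Rightarrow> nat \<Rightarrow> (nat \<Rightarrow> 'k) set" where
  "P_y K l =
     P_ideal K l +>\<^bsub>UP (max_order K)\<^esub> up_ring.monom (UP (max_order K)) \<one>\<^bsub>max_order K\<^esub> 1"

definition P_const :: "'k::field_char_0 set \<Rightarrow> nat \<Rightarrow> 'k \<Rightarrow> (nat \<Rightarrow> 'k) set" where
  "P_const K l c = P_ideal K l +>\<^bsub>UP (max_order K)\<^esub> up_ring.monom (UP (max_order K)) c 0"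

text \<open>
  Only the additive and the scalar part of a \<open>module\<close> record are relevant for modules; the fields
  \<open>mult\<close> and \<open>one\<close> are junk. All rings of scalars are commutative, so right modules are
  written with the library's scalar multiplication from the left: \<open>m y\<close> is \<open>y \<odot> m\<close>.
\<close>
definition quotient_module :: "('a, 'm) module \<Rightarrow> 'm set \<Rightarrow> ('a, 'm set) module" where
  "quotient_module M N =
     \<lparr>carrier = a_rcosets\<^bsub>M\<^esub> N, monoid.mult = undefined, one = undefined, ring.zero = N,
      ring.add = set_add M,
      module.smult = (\<lambda>a C. N <+>\<^bsub>M\<^esub> ((\<lambda>x. a \<odot>\<^bsub>M\<^esub> x) ` C))\<rparr>"

definition restrict_scalars :: "('b \<Rightarrow> 'a) \<Rightarrow> ('a, 'm) module \<Rightarrow> ('b, 'm) module" where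
  "restrict_scalars f M =
     \<lparr>carrier = carrier M, monoid.mult = monoid.mult M, one = one M, ring.zero = ring.zero M,
      ring.add = ring.add M,
      module.smult = (\<lambda>b x. f b \<odot>\<^bsub>M\<^esub> x)\<rparr>"

text \<open>Basis as unique finite linear combinations; \<open>B\<close> may be infinite, so \<open>c\<close> has finite support.\<close>
definition free_module :: "('a, 'c) ring_scheme \<Rightarrow> ('a, 'm) module \<Rightarrow> bool" where
  "free_module R M \<longleftrightarrow> module R M \<and>
     (\<exists>B \<subseteq> carrier M. \<forall>x \<in> carrier M.
        \<exists>!c. c \<in> (B \<rightarrow>\<^sub>E carrier R) \<and> finite {b \<in> B. c b \<noteq> \<zero>\<^bsub>R\<^esub>} \<and>
             x = (\<Oplus>\<^bsub>M\<^esub>b \<in> {b \<in> B. c b \<noteq> \<zero>\<^bsub>R\<^esub>}. c b \<odot>\<^bsub>M\<^esub> b))"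

text \<open>The rank \<open>n = 0\<close> is allowed: the zero module is integral.\<close>
definition integral_module ::
    "'k::field_char_0 set \<Rightarrow> nat \<Rightarrow> ((nat \<Rightarrow> 'k) set, 'm) module \<Rightarrow> bool" where
  "integral_module K l M \<longleftrightarrow> module (P_ring K l) M \<and>
     (\<exists>n::nat. add_monoid M \<cong> product_group {..<n} (\<lambda>_. integer_group))"

definition K_sub ::
    "'k::field_char_0 set \<Rightarrow> nat \<Rightarrow> ((nat \<Rightarrow> 'k) set, 'm) module \<Rightarrow> nat \<Rightarrow> 'm set" where
  "K_sub K l M i = {m \<in> carrier M. (P_y K l [^]\<^bsub>P_ring K l\<^esub> i) \<odot>\<^bsub>M\<^esub> m = \<zero>\<^bsub>M\<^esub>}"

text \<open>Used for \<open>i \<ge> 1\<close> only, where \<open>i - 1\<close> is not truncated.\<close>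
definition L_sub ::
    "'k::field_char_0 set \<Rightarrow> nat \<Rightarrow> ((nat \<Rightarrow> 'k) set, 'm) module \<Rightarrow> nat \<Rightarrow> 'm set" where
  "L_sub K l M i =
     ((\<lambda>m. P_y K l \<odot>\<^bsub>M\<^esub> m) ` K_sub K l M (i + 1)) <+>\<^bsub>M\<^esub> K_sub K l M (i - 1)"

definition Q_mod ::
    "'k::field_char_0 set \<Rightarrow> nat \<Rightarrow> ((nat \<Rightarrow> 'k) set, 'm) module \<Rightarrow> nat \<Rightarrow> ('k, 'm set) module"
  where
  "Q_mod K l M i =
     restrict_scalars (P_const K l)
       (quotient_module (M\<lparr>carrier := K_sub K l M i\<rparr>) (L_sub K l M i))"

definition standard_module ::
    "'k::field_char_0 set \<Rightarrow> nat \<Rightarrow> ((nat \<Rightarrow> 'k) set, 'm) module \<Rightarrow> bool" where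
  "standard_module K l M \<longleftrightarrow> integral_module K l M \<and>
     (\<forall>i\<in>{1..l}. free_module (max_order K) (Q_mod K l M i))"

definition standard_submodule ::
    "'k::field_char_0 set \<Rightarrow> nat \<Rightarrow> ((nat \<Rightarrow> 'k) set, 'm) module \<Rightarrow> 'm set \<Rightarrow> bool" where
  "standard_submodule K l M S \<longleftrightarrow>
     submodule S (P_ring K l) M \<and> standard_module K l (M\<lparr>carrier := S\<rparr>)"

definition finite_index :: "('a, 'm) module \<Rightarrow> 'm set \<Rightarrow> bool" where
  "finite_index M N \<longleftrightarrow> finite (a_rcosets\<^bsub>M\<^esub> N)"

definition index :: "('a, 'm) module \<Rightarrow> 'm set \<Rightarrow> nat" where
  "index M N = card (a_rcosets\<^bsub>M\<^esub> N)"

text \<open>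
  The map \<open>a + L\<^sub>i(S) \<mapsto> a + L\<^sub>i(M)\<close> is realised, independently of representatives, as adding the
  set \<open>L\<^sub>i(M)\<close> to a coset; that it has the stated effect on \<open>a + L\<^sub>i(S)\<close> is part of the theorem.
\<close>
definition rho ::
    "'k::field_char_0 set \<Rightarrow> nat \<Rightarrow> ((nat \<Rightarrow> 'k) set, 'm) module \<Rightarrow> nat \<Rightarrow> 'm set \<Rightarrow> 'm set"
  where "rho K l M i C = L_sub K l M i <+>\<^bsub>M\<^esub> C"

definition R_sub ::
    "'k::field_char_0 set \<Rightarrow> nat \<Rightarrow> ((nat \<Rightarrow> 'k) set, 'm) module \<Rightarrow> 'm set \<Rightarrow> nat \<Rightarrow> 'm set set"
  where "R_sub K l M S i = rho K l M i ` carrier (Q_mod K l (M\<lparr>carrier := S\<rparr>) i)"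

end

theory Submission
  imports Defs "HOL-Library.Equipollence"
begin

text \<open>
  Multiplication by \<open>y\<close> is an endomorphism \<open>T\<close> of the additive group of \<open>M\<close>, nilpotent because \<open>y\<close>
  to the power \<open>l\<close> vanishes in the ring, and \<open>S\<close> is a \<open>T\<close>-stable subgroup with \<open>K\<^sub>i(S) = K\<^sub>i(M) \<inter> S\<close>.
  Almost everything happens at this level, in the locale \<open>stable_subgroup\<close>.

  For the first part, let \<open>x = a y + b\<close> be an element of \<open>L\<^sub>i(M) \<inter> S\<close>. Some \<open>n > 0\<close> annihilates \<open>M/S\<close>,
  so \<open>n a\<close> and \<open>n b\<close> lie in \<open>S\<close>, and \<open>n x\<close> lies in \<open>L\<^sub>i(S)\<close>. Now \<open>Q\<^sub>i(S)\<close> is free over a ring of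
  characteristic \<open>0\<close> without zero divisors, hence torsion-free as an abelian group
  (\<open>free_module_torsion_free\<close>), which gives \<open>x \<in> L\<^sub>i(S)\<close> (\<open>Layer_Int_eq\<close>). This is exactly injectivity of
  \<open>\<rho>\<^sub>i\<close>; its image has finite index since \<open>K\<^sub>i(S)\<close> has finite index in \<open>K\<^sub>i(M)\<close>.

  For the second part, let \<open>g\<^sub>i\<close> be the index of the image of \<open>K\<^sub>i(S)\<close> in \<open>K\<^sub>i(M)/K\<^sub>i\<^sub>-\<^sub>1(M)\<close>. The filtration
  \<open>0 = K\<^sub>0 \<subseteq> K\<^sub>1 \<subseteq> \<dots> \<subseteq> K\<^sub>l = M\<close> shows that \<open>[M : S]\<close> is the product of the \<open>g\<^sub>i\<close>
  (\<open>card_Ker_Int_eq_prod\<close>). Multiplication by \<open>y\<close> embeds \<open>K\<^sub>i\<^sub>+\<^sub>1(M)/K\<^sub>i(M)\<close> into \<open>K\<^sub>i(M)/K\<^sub>i\<^sub>-\<^sub>1(M)\<close> with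
  cokernel \<open>Q\<^sub>i(M)\<close>, and likewise for \<open>S\<close>. By the first part these embeddings are compatible with
  intersecting with \<open>S\<close>, so \<open>g\<^sub>i = h\<^sub>i g\<^sub>i\<^sub>+\<^sub>1\<close> (\<open>graded_index_step\<close>). As \<open>g\<^sub>l\<^sub>+\<^sub>1 = 1\<close>, each \<open>g\<^sub>i\<close> is the product
  of the \<open>h\<^sub>j\<close> with \<open>j \<ge> i\<close>, which is the index formula.
\<close>

section \<open>Cosets of one subgroup in another\<close>

text \<open>
  Taking only those cosets of \<open>B\<close> that meet \<open>A\<close> avoids passing to \<open>A\<close> as a group of its own; for
  \<open>B \<subseteq> A\<close> the cardinality is the index \<open>[A : B]\<close>.
\<close>
definition coset_space :: "('a, 'b) monoid_scheme \<Rightarrow> 'a set \<Rightarrow> 'a set \<Rightarrow> 'a set set" where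
  "coset_space G A B = (\<lambda>a. B #>\<^bsub>G\<^esub> a) ` A"

lemma rcosets_eq_coset_space: "rcosets\<^bsub>G\<^esub> B = coset_space G (carrier G) B"
  by (auto simp: RCOSETS_def coset_space_def)

lemma coset_space_carrier_update [simp]:
  "coset_space (G\<lparr>carrier := C\<rparr>) A B = coset_space G A B"
  by (simp add: coset_space_def r_coset_def)

lemma (in group) rcos_eq_iff:
  assumes "subgroup B G" "a \<in> carrier G" "b \<in> carrier G"
  shows "B #> a = B #> b \<longleftrightarrow> a \<otimes> inv b \<in> B"
  using assms repr_independence rcos_self subgroup.rcos_module[OF assms(1) is_group]
  by metis

text \<open>
  Both images are the quotient of \<open>A\<close> by the same equivalence relation.
\<close>
lemma image_eqpoll_image:
  assumes "\<And>a b. a \<in> A \<Longrightarrow> b \<in> A \<Longrightarrow> u a = u b \<longleftrightarrow> v a = v b"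
  shows "u ` A \<approx> v ` A"
proof -
  have "bij_betw (\<lambda>U. v (SOME a. a \<in> A \<and> u a = U)) (u ` A) (v ` A)"
  proof (rule bij_betw_imageI)
    have *: "v (SOME c. c \<in> A \<and> u c = u a) = v a" if "a \<in> A" for a
    proof -
      have "(SOME c. c \<in> A \<and> u c = u a) \<in> A \<and> u (SOME c. c \<in> A \<and> u c = u a) = u a"
        by (rule someI[of _ a]) (use that in simp)
      then show ?thesis using assms that by blast
    qed
    show "inj_on (\<lambda>U. v (SOME a. a \<in> A \<and> u a = U)) (u ` A)"
      using assms by (auto simp: inj_on_def *)
    show "(\<lambda>U. v (SOME a. a \<in> A \<and> u a = U)) ` u ` A = v ` A"
      by (auto simp: * image_image)
  qed
  then show ?thesis unfolding eqpoll_def by blast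
qed

text \<open>
  This covers all the isomorphism theorems used below. The second hypothesis on \<open>f\<close> says that every
  element of \<open>A'\<close> is congruent to a value of \<open>f\<close> modulo \<open>B'\<close>, the third that two elements of \<open>A\<close>
  are congruent modulo \<open>B\<close> iff their images are so modulo \<open>B'\<close>. Hence \<open>f\<close> induces a
  bijection \<open>A/B \<rightarrow> A'/B'\<close>. With the identity for \<open>f\<close> one gets the second isomorphism theorem, with
  the projection onto a quotient the third.
\<close>
lemma coset_space_hom_eqpoll:
  assumes hom: "group_hom G H f"
    and A: "A \<subseteq> carrier G" and B: "subgroup B G"
    and A': "A' \<subseteq> carrier H" and B': "subgroup B' H"
    and into: "f ` A \<subseteq> A'"
    and onto: "\<And>a'. a' \<in> A' \<Longrightarrow> \<exists>a\<in>A. f a \<otimes>\<^bsub>H\<^esub> inv\<^bsub>H\<^esub> a' \<in> B'"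
    and preimage: "\<And>a b. a \<in> A \<Longrightarrow> b \<in> A \<Longrightarrow>
      f (a \<otimes>\<^bsub>G\<^esub> inv\<^bsub>G\<^esub> b) \<in> B' \<longleftrightarrow> a \<otimes>\<^bsub>G\<^esub> inv\<^bsub>G\<^esub> b \<in> B"
  shows "coset_space G A B \<approx> coset_space H A' B'"
proof -
  interpret group_hom G H f by (rule hom)
  have "coset_space H A' B' = (\<lambda>a. B' #>\<^bsub>H\<^esub> f a) ` A"
  proof
    show "(\<lambda>a. B' #>\<^bsub>H\<^esub> f a) ` A \<subseteq> coset_space H A' B'"
      using into by (auto simp: coset_space_def)
    show "coset_space H A' B' \<subseteq> (\<lambda>a. B' #>\<^bsub>H\<^esub> f a) ` A"
    proof
      fix U assume "U \<in> coset_space H A' B'"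
      then obtain a' where a': "a' \<in> A'" "U = B' #>\<^bsub>H\<^esub> a'" by (auto simp: coset_space_def)
      obtain a where a: "a \<in> A" "f a \<otimes>\<^bsub>H\<^esub> inv\<^bsub>H\<^esub> a' \<in> B'" using onto[OF a'(1)] by blast
      then have "B' #>\<^bsub>H\<^esub> f a = U"
        using H.rcos_eq_iff[OF B' hom_closed[OF subsetD[OF A a(1)]] subsetD[OF A' a'(1)]] a' by simp
      with a show "U \<in> (\<lambda>a. B' #>\<^bsub>H\<^esub> f a) ` A" by blast
    qed
  qed
  moreover have "(\<lambda>a. B #>\<^bsub>G\<^esub> a) ` A \<approx> (\<lambda>a. B' #>\<^bsub>H\<^esub> f a) ` A"
  proof (rule image_eqpoll_image)
    fix a b assume ab: "a \<in> A" "b \<in> A"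
    with A have c: "a \<in> carrier G" "b \<in> carrier G" by auto
    have "B' #>\<^bsub>H\<^esub> f a = B' #>\<^bsub>H\<^esub> f b \<longleftrightarrow> f (a \<otimes>\<^bsub>G\<^esub> inv\<^bsub>G\<^esub> b) \<in> B'"
      using H.rcos_eq_iff[OF B'] c by simp
    then show "B #>\<^bsub>G\<^esub> a = B #>\<^bsub>G\<^esub> b \<longleftrightarrow> B' #>\<^bsub>H\<^esub> f a = B' #>\<^bsub>H\<^esub> f b"
      using G.rcos_eq_iff[OF B c] preimage[OF ab] by simp
  qed
  ultimately show ?thesis by (simp add: coset_space_def)
qed

text \<open>
  A representative in every coset of \<open>B\<close> identifies that coset with \<open>B\<close> by translation. Stated
  as an equipollence, multiplicativity of the index needs no finiteness.
\<close>
lemma (in group) coset_space_eqpoll_Times: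
  assumes A: "subgroup A G" and B: "subgroup B G" and C: "subgroup C G"
    and "C \<subseteq> B" and "B \<subseteq> A"
  shows "coset_space G A C \<approx> coset_space G A B \<times> coset_space G B C"
proof -
  define rep where "rep U = (SOME a. a \<in> A \<and> U = B #> a)" for U
  have rep: "rep U \<in> A" "U = B #> rep U" if U: "U \<in> coset_space G A B" for U
  proof -
    obtain a where "a \<in> A \<and> U = B #> a" using U by (auto simp: coset_space_def)
    then have "rep U \<in> A \<and> U = B #> rep U" unfolding rep_def by (rule someI)
    then show "rep U \<in> A" "U = B #> rep U" by auto
  qed
  note [simp] = subgroup.mem_carrier[OF A] subgroup.mem_carrier[OF B] subgroup.mem_carrier[OF C]
  define \<phi> where "\<phi> = (\<lambda>(U, Y). Y #> rep U)"
  have "bij_betw \<phi> (coset_space G A B \<times> coset_space G B C) (coset_space G A C)"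
  proof (rule bij_betw_imageI)
    have \<phi>: "\<phi> (U, C #> b) = C #> (b \<otimes> rep U)" if "U \<in> coset_space G A B" "b \<in> B" for U b
      using that rep(1)[OF that(1)] coset_mult_assoc[OF subgroup.subset[OF C]] by (simp add: \<phi>_def)
    show "inj_on \<phi> (coset_space G A B \<times> coset_space G B C)"
    proof (rule inj_onI, clarify)
      fix U Y U' Y'
      assume U: "U \<in> coset_space G A B" "U' \<in> coset_space G A B"
        and Y: "Y \<in> coset_space G B C" "Y' \<in> coset_space G B C"
        and eq: "\<phi> (U, Y) = \<phi> (U', Y')"
      obtain b b' where b: "b \<in> B" "Y = C #> b" "b' \<in> B" "Y' = C #> b'"
        using Y by (auto simp: coset_space_def)
      note r = rep[OF U(1)] rep[OF U(2)]
      have "(b \<otimes> rep U) \<otimes> inv (b' \<otimes> rep U') \<in> C"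
        using eq b r \<phi> U rcos_eq_iff[OF C, of "b \<otimes> rep U" "b' \<otimes> rep U'"] by simp
      then have "b \<otimes> (rep U \<otimes> inv (rep U')) \<otimes> inv b' \<in> C"
        using b r by (simp add: inv_mult_group m_assoc)
      then have "b \<otimes> (rep U \<otimes> inv (rep U')) \<otimes> inv b' \<in> B" using \<open>C \<subseteq> B\<close> by auto
      then have "inv b \<otimes> (b \<otimes> (rep U \<otimes> inv (rep U')) \<otimes> inv b') \<otimes> b' \<in> B"
        using b B by (simp add: subgroup.m_closed subgroup.m_inv_closed)
      moreover have "inv b \<otimes> (b \<otimes> (rep U \<otimes> inv (rep U')) \<otimes> inv b') \<otimes> b'
          = rep U \<otimes> inv (rep U')"
        using b r by (simp add: inv_solve_left' m_assoc)
      ultimately have "rep U \<otimes> inv (rep U') \<in> B" by simp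
      then have UU: "U = U'" using r rcos_eq_iff[OF B, of "rep U" "rep U'"] by auto
      have "rep U' \<otimes> (inv (rep U') \<otimes> inv b') = inv b'"
        using b r by (simp add: m_assoc[symmetric])
      then have "b \<otimes> inv b' = (b \<otimes> rep U) \<otimes> inv (b' \<otimes> rep U')"
        using b r unfolding UU by (simp add: inv_mult_group m_assoc)
      with \<open>(b \<otimes> rep U) \<otimes> inv (b' \<otimes> rep U') \<in> C\<close> have "b \<otimes> inv b' \<in> C" by simp
      then have "Y = Y'" using b rcos_eq_iff[OF C, of b b'] by simp
      with UU show "U = U' \<and> Y = Y'" by simp
    qed
    show "\<phi> ` (coset_space G A B \<times> coset_space G B C) = coset_space G A C"
    proof
      show "\<phi> ` (coset_space G A B \<times> coset_space G B C) \<subseteq> coset_space G A C"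
      proof clarify
        fix U Y assume U: "U \<in> coset_space G A B" and "Y \<in> coset_space G B C"
        then obtain b where b: "b \<in> B" "Y = C #> b" by (auto simp: coset_space_def)
        then have "b \<otimes> rep U \<in> A" using rep(1)[OF U] \<open>B \<subseteq> A\<close> A by (auto intro: subgroup.m_closed)
        then show "\<phi> (U, Y) \<in> coset_space G A C" using \<phi> U b by (auto simp: coset_space_def)
      qed
      show "coset_space G A C \<subseteq> \<phi> ` (coset_space G A B \<times> coset_space G B C)"
      proof
        fix Z assume "Z \<in> coset_space G A C"
        then obtain a where a: "a \<in> A" "Z = C #> a" by (auto simp: coset_space_def)
        define U where "U = B #> a"
        have U: "U \<in> coset_space G A B" using a by (auto simp: U_def coset_space_def)
        note r = rep[OF U]
        have b: "a \<otimes> inv (rep U) \<in> B" using rcos_eq_iff[OF B, of a "rep U"] r a U_def by simp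
        have "a \<otimes> inv (rep U) \<otimes> rep U = a" using a r by (simp add: m_assoc)
        then have "\<phi> (U, C #> (a \<otimes> inv (rep U))) = Z" using \<phi>[OF U b] a by simp
        then show "Z \<in> \<phi> ` (coset_space G A B \<times> coset_space G B C)"
          using U b by (auto simp: coset_space_def intro!: image_eqI)
      qed
    qed
  qed
  then show ?thesis using eqpoll_sym unfolding eqpoll_def by blast
qed

lemma (in group) card_coset_space_tower:
  assumes "subgroup A G" "subgroup B G" "subgroup C G" "C \<subseteq> B" "B \<subseteq> A"
  shows "card (coset_space G A C) = card (coset_space G A B) * card (coset_space G B C)"
  using coset_space_eqpoll_Times[OF assms]
  by (metis bij_betw_same_card card_cartesian_product eqpoll_def)

text \<open>
  The coset of \<open>a\<close> modulo \<open>B'\<close> determines the one modulo \<open>B\<close>: two elements of \<open>A\<close> that agree modulo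
  \<open>B'\<close> differ by an element of \<open>A \<inter> B' \<subseteq> B\<close>.
\<close>
lemma (in group) finite_coset_space_mono:
  assumes B: "subgroup B G" and B': "subgroup B' G"
    and "A \<subseteq> A'" and "A' \<subseteq> carrier G" and "A \<inter> B' \<subseteq> B" and "subgroup A G"
    and fin: "finite (coset_space G A' B')"
  shows "finite (coset_space G A B)"
proof -
  have "coset_space G A B \<subseteq> (\<lambda>U. B <#> (A \<inter> U)) ` coset_space G A' B'"
  proof -
    have "B #> a = B <#> (A \<inter> (B' #> a))" if a: "a \<in> A" for a
    proof
      have "a \<in> B' #> a" using a assms rcos_self by blast
      then show "B #> a \<subseteq> B <#> (A \<inter> (B' #> a))"
        using a by (auto simp: r_coset_def set_mult_def)
      show "B <#> (A \<inter> (B' #> a)) \<subseteq> B #> a"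
      proof
        fix x assume "x \<in> B <#> (A \<inter> (B' #> a))"
        then obtain b c where bc: "b \<in> B" "c \<in> A" "c \<in> B' #> a" "x = b \<otimes> c"
          by (auto simp: set_mult_def)
        have car: "a \<in> carrier G" "c \<in> carrier G" "b \<in> carrier G" "x \<in> carrier G"
          using assms a bc subgroup.mem_carrier[OF B] by auto
        have "c \<otimes> inv a \<in> B'" using bc car subgroup.rcos_module[OF B' is_group] by blast
        moreover have "c \<otimes> inv a \<in> A" using assms(6) a bc
          by (simp add: subgroup.m_closed subgroup.m_inv_closed)
        ultimately have "c \<otimes> inv a \<in> B" using assms(5) by blast
        then have "b \<otimes> (c \<otimes> inv a) \<in> B" using bc B by (simp add: subgroup.m_closed)
        then have "x \<otimes> inv a \<in> B" using bc car by (simp add: m_assoc)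
        then show "x \<in> B #> a" using subgroup.rcos_module[OF B is_group] car by blast
      qed
    qed
    then show ?thesis using assms(3) by (auto simp: coset_space_def)
  qed
  then show ?thesis using fin finite_surj by blast
qed

lemma (in group) subset_set_mult:
  assumes "subgroup A G" "subgroup B G" shows "A \<subseteq> A <#> B" "B \<subseteq> A <#> B"
proof -
  note one = subgroup.one_closed[OF assms(1)] subgroup.one_closed[OF assms(2)]
  show "A \<subseteq> A <#> B"
    using one subgroup.mem_carrier[OF assms(1)] by (force simp: set_mult_def)
  show "B \<subseteq> A <#> B"
    using one subgroup.mem_carrier[OF assms(2)] by (force simp: set_mult_def)
qed

lemma (in group) set_mult_least:
  assumes "subgroup C G" "A \<subseteq> C" "B \<subseteq> C" shows "A <#> B \<subseteq> C"
  using assms by (auto simp: set_mult_def intro!: subgroup.m_closed)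

text \<open>
  The order of the finite quotient group is an exponent that works for all elements.
\<close>
lemma (in comm_group) finite_index_imp_pow_mem:
  assumes S: "subgroup S G" and fin: "finite (rcosets S)"
  obtains n :: nat where "n > 0" "\<And>x. x \<in> carrier G \<Longrightarrow> x [^] n \<in> S"
proof
  interpret N: normal S G using S by (rule subgroup_imp_normal)
  interpret Q: group "G Mod S" by (rule N.factorgroup_is_group)
  show "Coset.order (G Mod S) > 0"
    using fin Q.order_gt_0_iff_finite by (simp add: FactGroup_def)
  fix x assume x: "x \<in> carrier G"
  then have "S #> x \<in> carrier (G Mod S)" by (auto simp: FactGroup_def RCOSETS_def)
  then have "S #> (x [^] Coset.order (G Mod S)) = S"
    using Q.pow_order_eq_1[of "S #> x"] unfolding N.FactGroup_pow[OF x] by simp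
  then show "x [^] Coset.order (G Mod S) \<in> S" using coset_join1 x S by blast
qed

section \<open>The kernel filtration of an endomorphism\<close>

text \<open>
  The module structure matters only through the additive group and the endomorphism
  \<open>T : m \<mapsto> m y\<close>; a submodule enters as a subgroup that \<open>T\<close> maps into itself. The
  notation is multiplicative because the additive group of a module is the group
  \<^term>\<open>add_monoid\<close>, to which all results on subgroups and cosets apply.
\<close>
locale stable_subgroup = comm_group G for G (structure) +
  fixes T :: "'a \<Rightarrow> 'a" and S :: "'a set"
  assumes T_hom: "T \<in> hom G G"
    and S_subgroup: "subgroup S G"
    and T_S: "T ` S \<subseteq> S"
begin

sublocale T: group_hom G G T
  using T_hom by unfold_locales

definition Ker :: "nat \<Rightarrow> 'a set" where
  "Ker i = {x \<in> carrier G. (T ^^ i) x = \<one>}"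

text \<open>
  For \<open>A\<close> the whole group this is \<open>L\<^sub>i(M)\<close>, and for \<open>A = S\<close> it is \<open>L\<^sub>i(S)\<close>.
\<close>
definition Layer :: "'a set \<Rightarrow> nat \<Rightarrow> 'a set" where
  "Layer A i = T ` (Ker (i + 1) \<inter> A) <#> (Ker (i - 1) \<inter> A)"

lemma funpow_T_hom: "T ^^ i \<in> hom G G"
  by (induction i) (use T_hom in \<open>auto simp: hom_def Pi_def\<close>)

lemma Ker_0: "Ker 0 = {\<one>}"
  by (auto simp: Ker_def)

lemma subgroup_Ker: "subgroup (Ker i) G"
proof -
  interpret p: group_hom G G "T ^^ i" using funpow_T_hom by unfold_locales
  show ?thesis using p.subgroup_kernel by (simp add: Ker_def kernel_def)
qed

lemma Ker_carrier: "x \<in> Ker i \<Longrightarrow> x \<in> carrier G"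
  by (simp add: Ker_def)

lemma T_mem_Ker_iff: "x \<in> carrier G \<Longrightarrow> T x \<in> Ker i \<longleftrightarrow> x \<in> Ker (Suc i)"
  by (simp add: Ker_def funpow_swap1)

lemma Ker_Suc_mono: "Ker i \<subseteq> Ker (Suc i)"
  by (auto simp: Ker_def)

lemma Ker_mono: "i \<le> j \<Longrightarrow> Ker i \<subseteq> Ker j"
  using lift_Suc_mono_le[of Ker] Ker_Suc_mono by blast

lemma subgroup_Ker_Int: "subgroup A G \<Longrightarrow> subgroup (Ker i \<inter> A) G"
  using subgroup_Ker subgroups_Inter_pair by blast

lemma subgroup_Layer: "subgroup A G \<Longrightarrow> subgroup (Layer A i) G"
  unfolding Layer_def
  by (intro mult_subgroups T.subgroup_img_is_subgroup subgroup_Ker_Int)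

lemma Ker_Int_subset_Layer:
  assumes A: "subgroup A G" shows "Ker (i - 1) \<inter> A \<subseteq> Layer A i"
proof
  fix x assume x: "x \<in> Ker (i - 1) \<inter> A"
  have "\<one> \<in> T ` (Ker (i + 1) \<inter> A)"
    using subgroup.one_closed[OF T.subgroup_img_is_subgroup[OF subgroup_Ker_Int[OF A]]] .
  moreover have "x = \<one> \<otimes> x" using x Ker_carrier by auto
  ultimately show "x \<in> Layer A i" using x unfolding Layer_def set_mult_def by blast
qed

lemma Layer_subset_Ker:
  assumes A: "subgroup A G" and "T ` A \<subseteq> A" shows "Layer A i \<subseteq> Ker i \<inter> A"
proof
  fix x assume "x \<in> Layer A i"
  then obtain a b where ab: "a \<in> Ker (Suc i)" "a \<in> A" "b \<in> Ker (i - 1)" "b \<in> A" "x = T a \<otimes> b"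
    by (auto simp: Layer_def set_mult_def)
  have "T a \<in> Ker i" using ab T_mem_Ker_iff Ker_carrier by blast
  moreover have "b \<in> Ker i" using ab Ker_mono[of "i - 1" i] by auto
  ultimately have "x \<in> Ker i" using ab(5) subgroup.m_closed[OF subgroup_Ker] by blast
  moreover have "x \<in> A" using ab assms subgroup.m_closed[OF A] by auto
  ultimately show "x \<in> Ker i \<inter> A" by blast
qed

lemma T_carrier: "T ` carrier G \<subseteq> carrier G"
  by auto

lemma Layer_mono: "A \<subseteq> B \<Longrightarrow> Layer A i \<subseteq> Layer B i"
  unfolding Layer_def set_mult_def by blast

text \<open>
  An element \<open>x\<close> of \<open>L\<^sub>i(M) \<inter> S\<close> is written as \<open>(T a) b\<close> with \<open>a\<close> and \<open>b\<close> in \<open>M\<close>. If \<open>n\<close> is an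
  exponent of \<open>M/S\<close>, then the powers of \<open>a\<close> and \<open>b\<close> with exponent \<open>n\<close> lie in \<open>S\<close>, so that of \<open>x\<close> lies
  in \<open>L\<^sub>i(S)\<close>, and torsion-freeness of \<open>Q\<^sub>i(S)\<close> removes the exponent.
\<close>
theorem Layer_Int_eq:
  assumes fin: "finite (rcosets S)"
    and torsion_free: "\<And>x n. x \<in> Ker i \<inter> S \<Longrightarrow> n > (0::nat) \<Longrightarrow> x [^] n \<in> Layer S i \<Longrightarrow> x \<in> Layer S i"
  shows "Layer S i = Layer (carrier G) i \<inter> S"
proof
  show "Layer S i \<subseteq> Layer (carrier G) i \<inter> S"
    using Layer_mono[OF subgroup.subset[OF S_subgroup]] Layer_subset_Ker[OF S_subgroup T_S] by blast
  show "Layer (carrier G) i \<inter> S \<subseteq> Layer S i"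
  proof
    fix x assume x: "x \<in> Layer (carrier G) i \<inter> S"
    then have xK: "x \<in> Ker i \<inter> S" using Layer_subset_Ker[OF subgroup_self T_carrier] by blast
    obtain a b where ab: "a \<in> Ker (i + 1)" "b \<in> Ker (i - 1)" "x = T a \<otimes> b"
      using x by (auto simp: Layer_def set_mult_def)
    note car = Ker_carrier[OF ab(1)] Ker_carrier[OF ab(2)]
    obtain n :: nat where n: "n > 0" "\<And>x. x \<in> carrier G \<Longrightarrow> x [^] n \<in> S"
      using finite_index_imp_pow_mem[OF S_subgroup fin] by blast
    have pow: "y [^] n \<in> Ker j" if "y \<in> Ker j" for y j
    proof -
      interpret H: group_hom G G "T ^^ j" using funpow_T_hom by unfold_locales
      show ?thesis using that by (simp add: Ker_def H.hom_nat_pow)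
    qed
    have "x [^] n = T (a [^] n) \<otimes> b [^] n"
      using ab car by (simp add: pow_mult_distrib m_comm T.hom_nat_pow)
    moreover have "a [^] n \<in> Ker (i + 1) \<inter> S" "b [^] n \<in> Ker (i - 1) \<inter> S"
      using n car pow ab by auto
    ultimately have "x [^] n \<in> Layer S i"
      unfolding Layer_def set_mult_def by blast
    then show "x \<in> Layer S i" using torsion_free xK n by blast
  qed
qed

abbreviation KS :: "nat \<Rightarrow> 'a set" where "KS i \<equiv> Ker i \<inter> S"

text \<open>
  The index of the image of \<open>K\<^sub>i(S)\<close> in the graded piece \<open>K\<^sub>i(M)/K\<^sub>i\<^sub>-\<^sub>1(M)\<close>.
\<close>
definition graded_index :: "nat \<Rightarrow> nat" where
  "graded_index i = card (coset_space G (Ker i) (Ker (i - 1) <#> KS i))"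

text \<open>
  The index of the image of \<open>K\<^sub>i(S)\<close> in \<open>Q\<^sub>i(M) = K\<^sub>i(M)/L\<^sub>i(M)\<close>; this is the number \<open>h\<^sub>i\<close>.
\<close>
definition layer_index :: "nat \<Rightarrow> nat" where
  "layer_index i = card (coset_space G (Ker i) (Layer (carrier G) i <#> KS i))"

text \<open>
  In the chain \<open>K\<^sub>i(S) \<subseteq> K\<^sub>i\<^sub>-\<^sub>1(M) K\<^sub>i(S) \<subseteq> K\<^sub>i(M)\<close> the upper index is the graded one, and the lower
  one is \<open>[K\<^sub>i\<^sub>-\<^sub>1(M) : K\<^sub>i\<^sub>-\<^sub>1(S)]\<close> by the second isomorphism theorem.
\<close>
lemma card_Ker_Int_eq_prod:
  "card (coset_space G (Ker i) (KS i)) = (\<Prod>k=1..i. graded_index k)"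
proof (induction i)
  case 0
  have "KS 0 = {\<one>}" using Ker_0 subgroup.one_closed[OF S_subgroup] by auto
  then show ?case by (simp add: coset_space_def Ker_0)
next
  case (Suc i)
  note sg = subgroup_Ker subgroup_Ker_Int[OF S_subgroup]
  let ?B = "Ker i <#> KS (Suc i)"
  have B: "subgroup ?B G" by (intro mult_subgroups sg)
  have "?B \<subseteq> Ker (Suc i)" using Ker_Suc_mono by (intro set_mult_least sg) auto
  then have "card (coset_space G (Ker (Suc i)) (KS (Suc i)))
      = graded_index (Suc i) * card (coset_space G ?B (KS (Suc i)))"
    using card_coset_space_tower[OF sg(1) B sg(2)] subset_set_mult(2)[OF sg]
    by (simp add: graded_index_def)
  moreover have "coset_space G (Ker i) (KS i) \<approx> coset_space G ?B (KS (Suc i))"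
  proof (rule coset_space_hom_eqpoll[where f = "\<lambda>x. x"])
    show "group_hom G G (\<lambda>x. x)" by unfold_locales (auto simp: hom_def)
    show "Ker i \<subseteq> carrier G" "?B \<subseteq> carrier G"
      using subgroup.subset sg B by blast+
    show "(\<lambda>x. x) ` Ker i \<subseteq> ?B" using subset_set_mult(1)[OF sg] by simp
  next
    fix b assume "b \<in> ?B"
    then obtain k s where ks: "k \<in> Ker i" "s \<in> KS (Suc i)" "b = k \<otimes> s"
      by (auto simp: set_mult_def)
    then have "k \<otimes> inv b = inv s"
      using Ker_carrier by (auto simp: inv_mult m_assoc[symmetric])
    then have "k \<otimes> inv b \<in> KS (Suc i)"
      using subgroup.m_inv_closed[OF sg(2) ks(2)] by simp
    then show "\<exists>a\<in>Ker i. a \<otimes> inv b \<in> KS (Suc i)" using ks by blast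
  next
    fix a b assume "a \<in> Ker i" "b \<in> Ker i"
    then have "a \<otimes> inv b \<in> Ker i" by (simp add: subgroup.m_closed subgroup.m_inv_closed sg)
    then show "a \<otimes> inv b \<in> KS (Suc i) \<longleftrightarrow> a \<otimes> inv b \<in> KS i" using Ker_Suc_mono by auto
  qed (use sg in auto)
  then have "card (coset_space G (Ker i) (KS i)) = card (coset_space G ?B (KS (Suc i)))"
    unfolding eqpoll_def using bij_betw_same_card by blast
  ultimately show ?case using Suc by simp
qed

text \<open>
  The recursion behind the index formula. The index
  \<open>[K\<^sub>i(M) : K\<^sub>i\<^sub>-\<^sub>1(M) K\<^sub>i(S)]\<close> splits at the subgroup \<open>L\<^sub>i(M) K\<^sub>i(S)\<close>, the upper part being \<open>h\<^sub>i\<close>. As \<open>L\<^sub>i(M)\<close>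
  is \<open>T(K\<^sub>i\<^sub>+\<^sub>1(M)) K\<^sub>i\<^sub>-\<^sub>1(M)\<close>, the endomorphism \<open>T\<close> maps \<open>K\<^sub>i\<^sub>+\<^sub>1(M)\<close> onto the lower quotient, and the
  elements sent to \<open>K\<^sub>i\<^sub>-\<^sub>1(M) K\<^sub>i(S)\<close> are those of \<open>K\<^sub>i(M) K\<^sub>i\<^sub>+\<^sub>1(S)\<close>. The hypothesis on \<open>L\<^sub>i(S)\<close> enters in
  this last claim: if \<open>T x = k s\<close> with \<open>k\<close> in \<open>K\<^sub>i\<^sub>-\<^sub>1(M)\<close> and \<open>s\<close> in \<open>K\<^sub>i(S)\<close>, then \<open>s\<close> lies in
  \<open>L\<^sub>i(M) \<inter> S = L\<^sub>i(S)\<close>, so up to \<open>K\<^sub>i\<^sub>-\<^sub>1(S)\<close> it is \<open>T t\<close> with \<open>t\<close> in \<open>K\<^sub>i\<^sub>+\<^sub>1(S)\<close>, and \<open>x\<close> differs from \<open>t\<close>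
  by an element of \<open>K\<^sub>i(M)\<close>.
\<close>
lemma graded_index_step:
  assumes "i > 0" and L: "Layer S i = Layer (carrier G) i \<inter> S"
  shows "graded_index i = layer_index i * graded_index (Suc i)"
proof -
  note sg = subgroup_Ker subgroup_Ker_Int[OF S_subgroup] subgroup_Layer[OF subgroup_self]
  let ?L = "Layer (carrier G) i"
  let ?B = "?L <#> KS i" and ?C = "Ker (i - 1) <#> KS i" and ?D = "Ker i <#> KS (Suc i)"
  have B: "subgroup ?B G" and C: "subgroup ?C G" and D: "subgroup ?D G"
    by (intro mult_subgroups sg)+
  have KL: "Ker (i - 1) \<subseteq> ?L"
    using Ker_Int_subset_Layer[OF subgroup_self, of i] Ker_carrier by blast
  have CB: "?C \<subseteq> ?B" using KL by (auto simp: set_mult_def)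
  have "?B \<subseteq> Ker i"
    using Layer_subset_Ker[OF subgroup_self T_carrier] by (intro set_mult_least sg) auto
  then have "graded_index i = layer_index i * card (coset_space G ?B ?C)"
    using card_coset_space_tower[OF sg(1) B C] CB
    by (simp add: graded_index_def layer_index_def)
  moreover have "coset_space G (Ker (Suc i)) ?D \<approx> coset_space G ?B ?C"
  proof (rule coset_space_hom_eqpoll[where f = T])
    show "group_hom G G T" by unfold_locales
    show "Ker (Suc i) \<subseteq> carrier G" "?B \<subseteq> carrier G"
      using subgroup.subset sg B by blast+
    have TL: "T ` Ker (Suc i) \<subseteq> ?L"
    proof clarify
      fix x assume x: "x \<in> Ker (Suc i)"
      moreover have "T x = T x \<otimes> \<one>" using Ker_carrier[OF x] by simp
      moreover have "\<one> \<in> Ker (i - 1)" using subgroup.one_closed[OF subgroup_Ker] .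
      ultimately show "T x \<in> ?L"
        using Ker_carrier[OF x] by (force simp: Layer_def set_mult_def)
    qed
    then show "T ` Ker (Suc i) \<subseteq> ?B" using subset_set_mult(1)[OF sg(3) sg(2)] by blast
    have kerS: "a \<otimes> inv b \<in> Ker (Suc i)" if "a \<in> Ker (Suc i)" "b \<in> Ker (Suc i)" for a b
      using that by (simp add: subgroup.m_closed subgroup.m_inv_closed sg)
    have "T x \<in> ?C \<longleftrightarrow> x \<in> ?D" if x: "x \<in> Ker (Suc i)" for x
    proof
      assume "x \<in> ?D"
      then obtain k s where ks: "k \<in> Ker i" "s \<in> Ker (Suc i)" "s \<in> S" "x = k \<otimes> s"
        by (auto simp: set_mult_def)
      have "T k \<in> Ker (i - 1)" using T_mem_Ker_iff[of k "i - 1"] ks Ker_carrier \<open>i > 0\<close> by simp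
      moreover have "T s \<in> KS i" using T_mem_Ker_iff[of s i] ks Ker_carrier T_S by auto
      moreover have "T x = T k \<otimes> T s" using ks Ker_carrier by auto
      ultimately show "T x \<in> ?C" by (auto simp: set_mult_def)
    next
      assume "T x \<in> ?C"
      then obtain k s where ks: "k \<in> Ker (i - 1)" "s \<in> KS i" "T x = k \<otimes> s"
        by (auto simp: set_mult_def)
      have car: "k \<in> carrier G" "s \<in> carrier G" "x \<in> carrier G"
        using ks x Ker_carrier by auto
      have "s = inv k \<otimes> T x" using ks car by (simp add: m_assoc[symmetric])
      moreover have "inv k \<in> ?L" using subgroup.m_inv_closed[OF sg(3)] KL ks(1) by blast
      moreover have "T x \<in> ?L" using TL x by blast
      ultimately have "s \<in> ?L" using subgroup.m_closed[OF sg(3)] by simp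
      then have "s \<in> Layer S i" using L ks by blast
      then obtain t u where tu: "t \<in> KS (Suc i)" "u \<in> Ker (i - 1)" "s = T t \<otimes> u"
        by (auto simp: Layer_def set_mult_def)
      have car': "t \<in> carrier G" "u \<in> carrier G" using tu Ker_carrier by auto
      have "T (x \<otimes> inv t) = k \<otimes> (T t \<otimes> u) \<otimes> inv (T t)"
        using ks tu car car' by simp
      also have "\<dots> = k \<otimes> u \<otimes> (T t \<otimes> inv (T t))"
        using car car' by (simp only: m_ac T.hom_closed inv_closed m_closed)
      also have "\<dots> = k \<otimes> u" using car car' by simp
      finally have "T (x \<otimes> inv t) \<in> Ker (i - 1)"
        using subgroup.m_closed[OF sg(1) ks(1) tu(2)] by simp
      then have "x \<otimes> inv t \<in> Ker i"
        using T_mem_Ker_iff[of "x \<otimes> inv t" "i - 1"] car car' \<open>i > 0\<close> by simp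
      moreover have "x = (x \<otimes> inv t) \<otimes> t" using car car' by (simp add: m_assoc)
      ultimately show "x \<in> ?D" using tu(1) unfolding set_mult_def by blast
    qed
    then show "T (a \<otimes> inv b) \<in> ?C \<longleftrightarrow> a \<otimes> inv b \<in> ?D"
      if "a \<in> Ker (Suc i)" "b \<in> Ker (Suc i)" for a b
      using kerS that by blast
  next
    fix b assume "b \<in> ?B"
    then obtain x k s where xks: "x \<in> Ker (Suc i)" "k \<in> Ker (i - 1)" "s \<in> KS i" "b = T x \<otimes> k \<otimes> s"
      by (auto simp: Layer_def set_mult_def)
    have car: "k \<in> carrier G" "s \<in> carrier G" "x \<in> carrier G"
      using xks Ker_carrier by auto
    then have "T x \<otimes> inv b = inv k \<otimes> inv s"
      using xks(4) by (simp add: inv_mult m_assoc[symmetric])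
    moreover have "inv k \<in> Ker (i - 1)" "inv s \<in> KS i"
      using subgroup.m_inv_closed[OF sg(1) xks(2)] subgroup.m_inv_closed[OF sg(2) xks(3)] .
    ultimately have "T x \<otimes> inv b \<in> ?C" by (auto simp: set_mult_def)
    then show "\<exists>a\<in>Ker (Suc i). T a \<otimes> inv b \<in> ?C" using xks by blast
  qed (use C D in auto)
  ultimately show ?thesis
    unfolding eqpoll_def graded_index_def using bij_betw_same_card by fastforce
qed

text \<open>
  If the filtration reaches the whole group at \<open>l\<close>, then the graded index at \<open>l + 1\<close> is \<open>1\<close>, so the
  recursion gives each graded index as a product of \<open>h\<^sub>j\<close> with \<open>j \<ge> i\<close>.
\<close>
theorem index_eq_prod_layer_index:
  assumes nil: "Ker l = carrier G"
    and L: "\<And>i. i \<in> {1..l} \<Longrightarrow> Layer S i = Layer (carrier G) i \<inter> S"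
  shows "card (rcosets S) = (\<Prod>i=1..l. \<Prod>j=i..l. layer_index j)"
proof -
  have top: "graded_index (Suc l) = 1"
  proof -
    have "Ker (Suc l) = carrier G" using Ker_Suc_mono[of l] nil Ker_carrier by blast
    moreover have "Ker l <#> KS (Suc l) = carrier G"
      using subset_set_mult(1)[OF subgroup_Ker subgroup_Ker_Int[OF S_subgroup], of l "Suc l"] nil
        setmult_subset_G[of "Ker l" "KS (Suc l)"] Ker_carrier by auto
    moreover have "coset_space G (carrier G) (carrier G) = {carrier G}"
      using coset_join2[OF _ subgroup_self] by (auto simp: coset_space_def)
    ultimately show ?thesis by (simp add: graded_index_def)
  qed
  have "graded_index i = (\<Prod>j=i..l. layer_index j)" if "1 \<le> i" "i \<le> Suc l" for i
    using that(2,1)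
  proof (induction rule: inc_induct)
    case base
    show ?case using top by simp
  next
    case (step i)
    then show ?case using graded_index_step[of i] L[of i]
      by (simp add: prod.atLeast_Suc_atMost)
  qed
  moreover have "KS l = S" using nil subgroup.subset[OF S_subgroup] by auto
  then have "card (rcosets S) = (\<Prod>i=1..l. graded_index i)"
    using card_Ker_Int_eq_prod[of l] nil by (simp add: rcosets_eq_coset_space)
  ultimately show ?thesis by simp
qed

end

text \<open>
  The third isomorphism theorem: the index of the image of \<open>B\<close> in \<open>A/N\<close> is that of \<open>N B\<close> in \<open>A\<close>.
\<close>
lemma (in comm_group) coset_space_quotient_eqpoll:
  assumes A: "subgroup A G" and N: "subgroup N G" and B: "subgroup B G"
    and "N \<subseteq> A" and "B \<subseteq> A"
  shows "coset_space G A (N <#> B)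
    \<approx> rcosets\<^bsub>G\<lparr>carrier := A\<rparr> Mod N\<^esub> ((\<lambda>a. N #> a) ` B)"
proof -
  let ?G = "G\<lparr>carrier := A\<rparr>" and ?B' = "(\<lambda>a. N #> a) ` B"
  interpret GA: group ?G using A by (rule subgroup_imp_group)
  interpret normal N ?G
    using normal_restrict_supergroup[OF A subgroup_imp_normal[OF N] \<open>N \<subseteq> A\<close>] .
  interpret Q: group "?G Mod N" by (rule factorgroup_is_group)
  have pi: "(\<lambda>a. N #> a) \<in> hom ?G (?G Mod N)"
    using r_coset_hom_Mod by (simp add: r_coset_def)
  have pi_hom: "group_hom ?G (?G Mod N) (\<lambda>a. N #> a)"
    using pi by unfold_locales
  then interpret pi: group_hom ?G "?G Mod N" "\<lambda>a. N #> a" .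
  have NB: "subgroup (N <#> B) G" by (rule mult_subgroups[OF N B])
  have NBA: "N <#> B \<subseteq> A"
    using assms(4,5) subgroup.m_closed[OF A] by (auto simp: set_mult_def)
  have B': "subgroup ?B' (?G Mod N)"
    by (rule pi.subgroup_img_is_subgroup) (rule subgroup_incl[OF B A \<open>B \<subseteq> A\<close>])
  have carrier_Q: "carrier (?G Mod N) = (\<lambda>a. N #> a) ` A"
    by (auto simp: FactGroup_def RCOSETS_def r_coset_def)
  have mem: "N #> x \<in> ?B' \<longleftrightarrow> x \<in> N <#> B" if x: "x \<in> A" for x
  proof
    assume "N #> x \<in> ?B'"
    then obtain b where b: "b \<in> B" "N #> x = N #> b" by auto
    then have "x \<in> N #> b" using rcos_self[OF _ N] x subgroup.mem_carrier[OF A] by blast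
    then show "x \<in> N <#> B" using b by (auto simp: r_coset_def set_mult_def)
  next
    assume "x \<in> N <#> B"
    then obtain n b where nb: "n \<in> N" "b \<in> B" "x = n \<otimes> b" by (auto simp: set_mult_def)
    then have "x \<in> N #> b" by (auto simp: r_coset_def)
    then have "N #> b = N #> x"
      using repr_independence[OF _ _ N] nb subgroup.mem_carrier[OF B] by blast
    then show "N #> x \<in> ?B'" using nb by auto
  qed
  have "coset_space ?G A (N <#> B) \<approx> coset_space (?G Mod N) (carrier (?G Mod N)) ?B'"
  proof (rule coset_space_hom_eqpoll[OF pi_hom])
    show "subgroup (N <#> B) ?G" by (rule subgroup_incl[OF NB A NBA])
    show "subgroup ?B' (?G Mod N)" by (rule B')
    show "(\<lambda>a. N #> a) ` A \<subseteq> carrier (?G Mod N)" by (simp add: carrier_Q)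
  next
    fix U assume U: "U \<in> carrier (?G Mod N)"
    then obtain a where "a \<in> A" "U = N #> a" by (auto simp: carrier_Q)
    then show "\<exists>a\<in>A. (N #> a) \<otimes>\<^bsub>?G Mod N\<^esub> inv\<^bsub>?G Mod N\<^esub> U \<in> ?B'"
      using Q.r_inv[OF U] subgroup.one_closed[OF B'] by metis
  next
    fix a b assume "a \<in> A" "b \<in> A"
    then have "a \<otimes>\<^bsub>?G\<^esub> inv\<^bsub>?G\<^esub> b \<in> A" using GA.m_closed GA.inv_closed by simp
    then show "N #> (a \<otimes>\<^bsub>?G\<^esub> inv\<^bsub>?G\<^esub> b) \<in> ?B' \<longleftrightarrow> a \<otimes>\<^bsub>?G\<^esub> inv\<^bsub>?G\<^esub> b \<in> N <#> B"
      by (rule mem)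
  qed auto
  then show ?thesis by (simp add: rcosets_eq_coset_space)
qed

section \<open>Comparing the layer quotients of the group and the subgroup\<close>

context stable_subgroup
begin

lemma Ker_Int_carrier: "Ker i \<inter> carrier G = Ker i"
  using Ker_carrier by blast

text \<open>
  For \<open>A = S\<close> this is \<open>Q\<^sub>i(S)\<close>, and for the whole group it is \<open>Q\<^sub>i(M)\<close>.
\<close>
abbreviation Layer_quot :: "'a set \<Rightarrow> nat \<Rightarrow> 'a set monoid" where
  "Layer_quot A i \<equiv> G\<lparr>carrier := Ker i \<inter> A\<rparr> Mod Layer A i"

abbreviation LM :: "nat \<Rightarrow> 'a set" where "LM i \<equiv> Layer (carrier G) i"

lemma carrier_Layer_quot: "carrier (Layer_quot A i) = (\<lambda>a. Layer A i #> a) ` (Ker i \<inter> A)"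
  by (auto simp: FactGroup_def RCOSETS_def r_coset_def)

lemma normal_Layer:
  assumes "subgroup A G" "T ` A \<subseteq> A" shows "Layer A i \<lhd> G\<lparr>carrier := Ker i \<inter> A\<rparr>"
  using assms subgroup_Ker_Int subgroup_imp_normal subgroup_Layer Layer_subset_Ker
  by (intro normal_restrict_supergroup) auto

lemma mult_Layer_quot: "U \<otimes>\<^bsub>Layer_quot A i\<^esub> V = U <#> V"
  by (simp add: FactGroup_def set_mult_def)

text \<open>
  Connects torsion in the group \<open>Q\<^sub>i(S)\<close> with the hypothesis on elements under which
  \<open>L\<^sub>i(S) = L\<^sub>i(M) \<inter> S\<close> was shown.
\<close>
lemma Layer_saturated_if_quot_torsion_free:
  assumes torsion_free: "\<And>U. U \<in> carrier (Layer_quot S i) \<Longrightarrow>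
      U [^]\<^bsub>Layer_quot S i\<^esub> n = \<one>\<^bsub>Layer_quot S i\<^esub> \<Longrightarrow> U = \<one>\<^bsub>Layer_quot S i\<^esub>"
    and x: "x \<in> KS i" and "x [^] (n::nat) \<in> Layer S i"
  shows "x \<in> Layer S i"
proof -
  interpret N: normal "Layer S i" "G\<lparr>carrier := KS i\<rparr>"
    using S_subgroup T_S by (rule normal_Layer)
  note LS = subgroup_Layer[OF S_subgroup]
  have xG: "x \<in> carrier G" using x Ker_carrier by auto
  have "(Layer S i #> x) [^]\<^bsub>Layer_quot S i\<^esub> n = Layer S i #> (x [^] n)"
    using N.FactGroup_pow[of x n] x by (simp add: r_coset_def nat_pow_consistent[symmetric])
  also have "\<dots> = Layer S i" using coset_join2[OF _ LS] assms(3) xG by simp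
  finally have "Layer S i #> x = Layer S i"
    using torsion_free[of "Layer S i #> x"] x carrier_Layer_quot by (simp add: FactGroup_def)
  then show ?thesis using coset_join1 xG LS by blast
qed

text \<open>
  The map of multiplying a coset by \<open>L\<^sub>i(M)\<close> is \<open>a L\<^sub>i(S) \<mapsto> a L\<^sub>i(M)\<close>, because \<open>L\<^sub>i(S) \<subseteq> L\<^sub>i(M)\<close>.
\<close>
lemma Layer_mult_coset:
  assumes "a \<in> KS i"
  shows "LM i <#> (Layer S i #> a) = LM i #> a"
proof -
  note sub = subgroup_Layer[OF subgroup_self] subgroup_Layer[OF S_subgroup]
  have "LM i <#> Layer S i = LM i"
    using set_mult_least[OF sub(1) order_refl Layer_mono[OF subgroup.subset[OF S_subgroup]]]
      subset_set_mult(1)[OF sub] by blast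
  then show ?thesis
    using setmult_rcos_assoc[OF sub[THEN subgroup.subset], of a] assms Ker_carrier by auto
qed

lemma Layer_mult_hom:
  "(\<lambda>U. LM i <#> U) \<in> hom (Layer_quot S i) (Layer_quot (carrier G) i)"
proof (rule homI)
  fix U assume "U \<in> carrier (Layer_quot S i)"
  then show "LM i <#> U \<in> carrier (Layer_quot (carrier G) i)"
    using Layer_mult_coset Ker_carrier by (auto simp: carrier_Layer_quot)
next
  fix U V assume "U \<in> carrier (Layer_quot S i)" "V \<in> carrier (Layer_quot S i)"
  then obtain a b where ab: "a \<in> KS i" "U = Layer S i #> a" "b \<in> KS i" "V = Layer S i #> b"
    by (auto simp: carrier_Layer_quot)
  have abS: "a \<otimes> b \<in> KS i"
    using ab subgroup.m_closed[OF subgroup_Ker_Int[OF S_subgroup]] by blast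
  have car: "a \<in> carrier G" "b \<in> carrier G" using ab Ker_carrier by auto
  note rsum = normal.rcos_sum[OF subgroup_imp_normal[OF subgroup_Layer]]
  show "LM i <#> (U \<otimes>\<^bsub>Layer_quot S i\<^esub> V)
      = (LM i <#> U) \<otimes>\<^bsub>Layer_quot (carrier G) i\<^esub> (LM i <#> V)"
    using ab car Layer_mult_coset[OF abS]
    by (simp add: mult_Layer_quot Layer_mult_coset rsum[OF S_subgroup] rsum[OF subgroup_self])
qed

lemma Layer_mult_inj:
  assumes L: "Layer S i = LM i \<inter> S"
  shows "inj_on (\<lambda>U. LM i <#> U) (carrier (Layer_quot S i))"
proof (rule inj_onI)
  fix U V assume "U \<in> carrier (Layer_quot S i)" "V \<in> carrier (Layer_quot S i)" and eq: "LM i <#> U = LM i <#> V"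
  then obtain a b where ab: "a \<in> KS i" "U = Layer S i #> a" "b \<in> KS i" "V = Layer S i #> b"
    by (auto simp: carrier_Layer_quot)
  have car: "a \<in> carrier G" "b \<in> carrier G" using ab Ker_carrier by auto
  have "a \<otimes> inv b \<in> LM i"
    using eq ab Layer_mult_coset rcos_eq_iff[OF subgroup_Layer[OF subgroup_self] car] by simp
  moreover have "a \<otimes> inv b \<in> S"
    using ab by (simp add: subgroup.m_closed subgroup.m_inv_closed S_subgroup)
  ultimately show "U = V"
    using rcos_eq_iff[OF subgroup_Layer[OF S_subgroup] car] L ab by blast
qed

lemma Layer_mult_image:
  "(\<lambda>U. LM i <#> U) ` carrier (Layer_quot S i) = (\<lambda>a. LM i #> a) ` KS i"
  unfolding carrier_Layer_quot image_image using Layer_mult_coset by (intro image_cong) auto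

lemma rcosets_Layer_quot_eqpoll:
  "coset_space G (Ker i) (LM i <#> KS i)
    \<approx> rcosets\<^bsub>Layer_quot (carrier G) i\<^esub> ((\<lambda>U. LM i <#> U) ` carrier (Layer_quot S i))"
  using coset_space_quotient_eqpoll[OF subgroup_Ker subgroup_Layer[OF subgroup_self]
      subgroup_Ker_Int[OF S_subgroup], of i i i]
    Layer_subset_Ker[OF subgroup_self T_carrier, of i] Layer_mult_image
  by (simp add: Ker_Int_carrier)

lemma card_rcosets_Layer_quot:
  "card (rcosets\<^bsub>Layer_quot (carrier G) i\<^esub> ((\<lambda>U. LM i <#> U) ` carrier (Layer_quot S i))) = layer_index i"
  using rcosets_Layer_quot_eqpoll bij_betw_same_card unfolding eqpoll_def layer_index_def by metis

lemma finite_rcosets_Layer_quot: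
  assumes "finite (rcosets S)"
  shows "finite (rcosets\<^bsub>Layer_quot (carrier G) i\<^esub> ((\<lambda>U. LM i <#> U) ` carrier (Layer_quot S i)))"
proof -
  note sg = subgroup_Layer[OF subgroup_self] subgroup_Ker_Int[OF S_subgroup]
  have "finite (coset_space G (Ker i) (LM i <#> KS i))"
  proof (rule finite_coset_space_mono[where A' = "carrier G" and B' = S])
    show "Ker i \<inter> S \<subseteq> LM i <#> KS i" using subset_set_mult(2)[OF sg] by simp
    show "subgroup (LM i <#> KS i) G" using mult_subgroups[OF sg] .
    show "finite (coset_space G (carrier G) S)" using assms by (simp add: rcosets_eq_coset_space)
    show "Ker i \<subseteq> carrier G" using Ker_carrier by blast
  qed (rule S_subgroup subgroup_Ker order_refl)+
  then show ?thesis using eqpoll_finite_iff[OF rcosets_Layer_quot_eqpoll] by blast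
qed

end

section \<open>Free modules are torsion-free\<close>

lemma (in module) add_pow_smult:
  assumes "c \<in> carrier R" "x \<in> carrier M"
  shows "(add_pow R (n::nat) c) \<odot>\<^bsub>M\<^esub> x = add_pow M n (c \<odot>\<^bsub>M\<^esub> x)"
  using assms
  by (induction n) (auto simp: smult_l_null smult_l_distr R.add.nat_pow_Suc M.add.nat_pow_Suc)

lemma (in abelian_group) add_pow_finsum:
  assumes "f \<in> A \<rightarrow> carrier G"
  shows "add_pow G (n::nat) (\<Oplus>a\<in>A. f a) = (\<Oplus>a\<in>A. add_pow G n (f a))"
proof (induction n)
  case 0
  then show ?case by simp
next
  case (Suc n)
  have "(\<Oplus>a\<in>A. add_pow G (Suc n) (f a)) = (\<Oplus>a\<in>A. add_pow G n (f a) \<oplus> f a)"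
    using assms by (intro finsum_cong') (auto simp: Pi_iff)
  also have "\<dots> = (\<Oplus>a\<in>A. add_pow G n (f a)) \<oplus> (\<Oplus>a\<in>A. f a)"
    using assms by (intro finsum_addf) auto
  finally show ?case using Suc assms by simp
qed

text \<open>
  Multiplying the coordinates of \<open>x\<close> by \<open>n\<close> gives coordinates of \<open>n x = 0\<close>, which are unique, so all
  of them vanish.
\<close>
lemma free_module_torsion_free:
  assumes free: "free_module R N"
    and R: "\<And>c. c \<in> carrier R \<Longrightarrow> add_pow R n c = \<zero>\<^bsub>R\<^esub> \<Longrightarrow> c = \<zero>\<^bsub>R\<^esub>"
    and x: "x \<in> carrier N" and nx: "add_pow N (n::nat) x = \<zero>\<^bsub>N\<^esub>"
  shows "x = \<zero>\<^bsub>N\<^esub>"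
proof -
  interpret module R N using free by (simp add: free_module_def)
  obtain B where B: "B \<subseteq> carrier N" and free_B: "\<forall>x \<in> carrier N.
      \<exists>!c. c \<in> (B \<rightarrow>\<^sub>E carrier R) \<and> finite {b \<in> B. c b \<noteq> \<zero>\<^bsub>R\<^esub>} \<and>
           x = (\<Oplus>\<^bsub>N\<^esub>b \<in> {b \<in> B. c b \<noteq> \<zero>\<^bsub>R\<^esub>}. c b \<odot>\<^bsub>N\<^esub> b)"
    using free unfolding free_module_def by (elim conjE exE) (erule(1) that)
  define rep where "rep x c \<longleftrightarrow> c \<in> (B \<rightarrow>\<^sub>E carrier R) \<and> finite {b \<in> B. c b \<noteq> \<zero>\<^bsub>R\<^esub>} \<and>
      x = (\<Oplus>\<^bsub>N\<^esub>b \<in> {b \<in> B. c b \<noteq> \<zero>\<^bsub>R\<^esub>}. c b \<odot>\<^bsub>N\<^esub> b)" for x c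
  have basis: "\<exists>!c. rep x c" if "x \<in> carrier N" for x
    using free_B that unfolding rep_def by (rule bspec)
  obtain c where "rep x c" using basis[OF x] by blast
  then have cB: "c \<in> B \<rightarrow>\<^sub>E carrier R" and fin: "finite {b \<in> B. c b \<noteq> \<zero>\<^bsub>R\<^esub>}"
    and x_eq: "x = (\<Oplus>\<^bsub>N\<^esub>b \<in> {b \<in> B. c b \<noteq> \<zero>\<^bsub>R\<^esub>}. c b \<odot>\<^bsub>N\<^esub> b)"
    by (simp_all only: rep_def)
  define d where "d = (\<lambda>b\<in>B. add_pow R n (c b))"
  define z where "z = (\<lambda>b\<in>B. \<zero>\<^bsub>R\<^esub>)"
  have cR: "c b \<in> carrier R" if "b \<in> B" for b using cB that by auto
  \<comment> \<open>The supports have to be the same because the linear combinations run over the supports.\<close>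
  have supp: "{b \<in> B. d b \<noteq> \<zero>\<^bsub>R\<^esub>} = {b \<in> B. c b \<noteq> \<zero>\<^bsub>R\<^esub>}"
    using R cR by (auto simp: d_def)
  have "(\<Oplus>\<^bsub>N\<^esub>b \<in> {b \<in> B. d b \<noteq> \<zero>\<^bsub>R\<^esub>}. d b \<odot>\<^bsub>N\<^esub> b)
      = (\<Oplus>\<^bsub>N\<^esub>b \<in> {b \<in> B. c b \<noteq> \<zero>\<^bsub>R\<^esub>}. add_pow N n (c b \<odot>\<^bsub>N\<^esub> b))"
    unfolding supp using cR B
    by (intro M.finsum_cong') (auto simp: d_def add_pow_smult subset_iff)
  also have "\<dots> = add_pow N n x"
    unfolding x_eq using cR B by (intro M.add_pow_finsum[symmetric]) auto
  finally have "\<zero>\<^bsub>N\<^esub> = (\<Oplus>\<^bsub>N\<^esub>b \<in> {b \<in> B. d b \<noteq> \<zero>\<^bsub>R\<^esub>}. d b \<odot>\<^bsub>N\<^esub> b)"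
    using nx by simp
  then have "rep \<zero>\<^bsub>N\<^esub> d"
    using fin cR unfolding rep_def supp by (simp add: d_def)
  moreover have supp_z: "{b \<in> B. z b \<noteq> \<zero>\<^bsub>R\<^esub>} = {}" by (auto simp: z_def)
  have "rep \<zero>\<^bsub>N\<^esub> z" unfolding rep_def supp_z by (simp add: z_def)
  ultimately have "d = z" using basis[OF M.zero_closed] by blast
  then have "{b \<in> B. c b \<noteq> \<zero>\<^bsub>R\<^esub>} = {}" using supp supp_z by simp
  then show ?thesis unfolding x_eq by (simp only: M.finsum_empty)
qed

lemma add_pow_max_order: "add_pow (max_order K) (n::nat) c = of_nat n * c"
  by (induction n)
    (auto simp: max_order_def ring_of_type_algebra_def add_pow_def nat_pow_def algebra_simps)

section \<open>The action of y\<close>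

lemma (in UP_cring) monom_one_pow: "up_ring.monom P \<one> 1 [^]\<^bsub>P\<^esub> (i::nat) = up_ring.monom P \<one> i"
proof (induction i)
  case 0
  show ?case by simp
next
  case (Suc i)
  then show ?case using monom_one_Suc[of i] by simp
qed

lemma (in UP_cring) monom_nilpotent_mod:
  fixes l :: nat
  defines "I \<equiv> PIdl\<^bsub>P\<^esub> (up_ring.monom P \<one> l)"
  shows "I +>\<^bsub>P\<^esub> up_ring.monom P \<one> 1 \<in> carrier (P Quot I)"
    and "(I +>\<^bsub>P\<^esub> up_ring.monom P \<one> 1) [^]\<^bsub>P Quot I\<^esub> l = \<zero>\<^bsub>P Quot I\<^esub>"
proof -
  have m: "up_ring.monom P \<one> i \<in> carrier P" for i by simp
  interpret I: ideal I P unfolding I_def by (rule P.cgenideal_ideal[OF m])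
  interpret h: ring_hom_ring P "P Quot I" "\<lambda>p. I +>\<^bsub>P\<^esub> p"
    by (rule I.rcos_ring_hom_ring)
  show "I +>\<^bsub>P\<^esub> up_ring.monom P \<one> 1 \<in> carrier (P Quot I)" by (rule h.hom_closed[OF m])
  have "(I +>\<^bsub>P\<^esub> up_ring.monom P \<one> 1) [^]\<^bsub>P Quot I\<^esub> l = I +>\<^bsub>P\<^esub> up_ring.monom P \<one> l"
    using h.hom_nat_pow[OF m, of 1 l] by (simp only: monom_one_pow)
  moreover have "up_ring.monom P \<one> l \<in> I"
    unfolding I_def by (rule P.cgenideal_self[OF m])
  then have "I +>\<^bsub>P\<^esub> up_ring.monom P \<one> l = I" by (rule I.a_rcos_const)
  moreover have "\<zero>\<^bsub>P Quot I\<^esub> = I" by (simp only: FactRing_def ring.simps)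
  ultimately show "(I +>\<^bsub>P\<^esub> up_ring.monom P \<one> 1) [^]\<^bsub>P Quot I\<^esub> l = \<zero>\<^bsub>P Quot I\<^esub>"
    by (simp only:)
qed

lemma P_y_nilpotent:
  assumes "cring (max_order K)"
  shows "P_y K l \<in> carrier (P_ring K l)" "P_y K l [^]\<^bsub>P_ring K l\<^esub> l = \<zero>\<^bsub>P_ring K l\<^esub>"
  unfolding P_y_def P_ring_def P_ideal_def
  using UP_cring.monom_nilpotent_mod[OF UP_cring.intro, OF assms, of l] .

lemma (in module) smult_pow_eq_funpow:
  assumes "y \<in> carrier R" "m \<in> carrier M"
  shows "(y [^]\<^bsub>R\<^esub> (i::nat)) \<odot>\<^bsub>M\<^esub> m = ((\<lambda>m. y \<odot>\<^bsub>M\<^esub> m) ^^ i) m"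
  using assms(2)
proof (induction i arbitrary: m)
  case 0
  then show ?case by simp
next
  case (Suc i)
  have "(y [^]\<^bsub>R\<^esub> Suc i) \<odot>\<^bsub>M\<^esub> m = (y [^]\<^bsub>R\<^esub> i) \<odot>\<^bsub>M\<^esub> (y \<odot>\<^bsub>M\<^esub> m)"
    using assms(1) Suc.prems by (simp add: smult_assoc1)
  then show ?case
    using Suc.IH[of "y \<odot>\<^bsub>M\<^esub> m"] assms(1) Suc.prems by (simp add: funpow_Suc_right del: funpow.simps)
qed

text \<open>
  On the underlying additive groups, the quotient module is the quotient group. The
  groups themselves have different record types, since \<^term>\<open>add_monoid\<close> keeps the scalar
  multiplication as an additional record field.
\<close>
lemma Q_mod_add_monoid:
  defines "Q \<equiv> \<lambda>K l M i. (add_monoid M)\<lparr>carrier := K_sub K l M i\<rparr> Mod L_sub K l M i"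
  shows carrier_Q_mod: "carrier (Q_mod K l M i) = carrier (Q K l M i)"
    and hom_Q_mod: "hom (add_monoid (Q_mod K l M i)) (add_monoid (Q_mod K l N j))
      = hom (Q K l M i) (Q K l N j)"
    and a_rcosets_Q_mod: "a_rcosets\<^bsub>Q_mod K l M i\<^esub> U = rcosets\<^bsub>Q K l M i\<^esub> U"
    and add_pow_Q_mod: "add_pow (Q_mod K l M i) (n::nat) V = V [^]\<^bsub>Q K l M i\<^esub> n"
    and zero_Q_mod: "\<zero>\<^bsub>Q_mod K l M i\<^esub> = \<one>\<^bsub>Q K l M i\<^esub>"
  by (simp_all add: Q_def Q_mod_def restrict_scalars_def quotient_module_def FactGroup_def
      A_RCOSETS_def RCOSETS_def r_coset_def set_add_def set_mult_def hom_def add_pow_def nat_pow_def)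

text \<open>
  Identifies the submodules \<open>K\<^sub>i\<close> and \<open>L\<^sub>i\<close> with the filtration of the endomorphism
  \<open>m \<mapsto> m y\<close>. A variable carrier \<open>A\<close> treats \<open>S\<close> and all of \<open>M\<close> at once.
\<close>
context
  fixes K :: "'k::field_char_0 set" and l :: nat
    and M :: "((nat \<Rightarrow> 'k) set, 'm) module" and S :: "'m set"
  assumes M: "module (P_ring K l) M" and S: "submodule S (P_ring K l) M"
    and cring_max_order: "cring (max_order K)"
begin

interpretation module "P_ring K l" M by (rule M)

lemma stable_subgroup_P_y: "stable_subgroup (add_monoid M) (\<lambda>m. P_y K l \<odot>\<^bsub>M\<^esub> m) S"
proof -
  interpret S: submodule S "P_ring K l" M by (rule S)
  show ?thesis
    using P_y_nilpotent(1)[OF cring_max_order] S.subgroup_axioms S.smult_closed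
    by unfold_locales (auto simp: hom_def smult_r_distr)
qed

interpretation Y: stable_subgroup "add_monoid M" "\<lambda>m. P_y K l \<odot>\<^bsub>M\<^esub> m" S
  by (rule stable_subgroup_P_y)

lemma K_sub_eq:
  assumes "A \<subseteq> carrier M" shows "K_sub K l (M\<lparr>carrier := A\<rparr>) i = Y.Ker i \<inter> A"
  using assms smult_pow_eq_funpow[OF P_y_nilpotent(1)[OF cring_max_order]]
  by (auto simp: K_sub_def Y.Ker_def)

lemma L_sub_eq:
  assumes "A \<subseteq> carrier M" shows "L_sub K l (M\<lparr>carrier := A\<rparr>) i = Y.Layer A i"
  by (simp add: L_sub_def Y.Layer_def K_sub_eq[OF assms] set_add_def set_mult_def)

lemma Ker_eq_carrier: "Y.Ker l = carrier M"
  using K_sub_eq[of "carrier M" l] P_y_nilpotent(2)[OF cring_max_order]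
  by (auto simp: K_sub_def Y.Ker_def smult_l_null)

end

section \<open>The index formula\<close>

lemma prod_triangle:
  fixes h :: "nat \<Rightarrow> 'a::comm_monoid_mult"
  shows "(\<Prod>i=1..l. \<Prod>j=i..l. h j) = (\<Prod>k=1..l. h k ^ k)"
proof (induction l)
  case 0
  then show ?case by simp
next
  case (Suc l)
  have "(\<Prod>i=1..l. \<Prod>j=i..Suc l. h j) = (\<Prod>i=1..l. (\<Prod>j=i..l. h j) * h (Suc l))"
    by (intro prod.cong) auto
  then show ?case using Suc by (simp add: prod.distrib mult.commute mult.assoc)
qed

theorem theorem3p18:
  fixes K :: "'k::field_char_0 set" and l :: nat
    and M :: "((nat \<Rightarrow> 'k) set, 'm) module" and S :: "'m set"
  assumes "number_field K"
    and "l > 0"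
    and "integral_module K l M"
    and "standard_submodule K l M S"
    and "finite_index M S"
  shows "(\<forall>i\<in>{1..l}.
            L_sub K l (M\<lparr>carrier := S\<rparr>) i = L_sub K l M i \<inter> S
          \<and> rho K l M i \<in> hom (add_monoid (Q_mod K l (M\<lparr>carrier := S\<rparr>) i))
                              (add_monoid (Q_mod K l M i))
          \<and> (\<forall>a \<in> K_sub K l (M\<lparr>carrier := S\<rparr>) i.
                rho K l M i (L_sub K l (M\<lparr>carrier := S\<rparr>) i +>\<^bsub>M\<^esub> a) = L_sub K l M i +>\<^bsub>M\<^esub> a)
          \<and> inj_on (rho K l M i) (carrier (Q_mod K l (M\<lparr>carrier := S\<rparr>) i))
          \<and> finite_index (Q_mod K l M i) (R_sub K l M S i))
       \<and> (\<forall>h. (\<forall>i\<in>{1..l}. h i = index (Q_mod K l M i) (R_sub K l M S i)) \<longrightarrow>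
            index M S = (\<Prod>i=1..l. \<Prod>j=i..l. h j)
          \<and> (\<Prod>i=1..l. \<Prod>j=i..l. h j) = (\<Prod>k=1..l. h k ^ k))"
proof -
  have M: "module (P_ring K l) M" using assms(3) by (simp add: integral_module_def)
  have S: "submodule S (P_ring K l) M" and std: "standard_module K l (M\<lparr>carrier := S\<rparr>)"
    using assms(4) by (simp_all add: standard_submodule_def)
  have free: "free_module (max_order K) (Q_mod K l (M\<lparr>carrier := S\<rparr>) i)" if "i \<in> {1..l}" for i
    using std that by (simp add: standard_module_def)
  \<comment> \<open>A free module is in particular a module, so its scalars form a commutative ring.\<close>
  have cr: "cring (max_order K)"
    using free[of 1] \<open>l > 0\<close> by (simp add: free_module_def module_def)
  interpret module "P_ring K l" M by (rule M)
  interpret Y: stable_subgroup "add_monoid M" "\<lambda>m. P_y K l \<odot>\<^bsub>M\<^esub> m" S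
    by (rule stable_subgroup_P_y[OF M S cr])
  have SM: "S \<subseteq> carrier M" using Y.S_subgroup subgroup.subset by fastforce
  note K_S = K_sub_eq[OF M S cr SM] and L_S = L_sub_eq[OF M S cr SM]
  have K_M: "K_sub K l M i = Y.Ker i" and L_M: "L_sub K l M i = Y.Layer (carrier M) i" for i
    using K_sub_eq[OF M S cr order_refl, of i] L_sub_eq[OF M S cr order_refl, of i]
      Y.Ker_Int_carrier[of i] by simp_all
  have Q_S: "(add_monoid (M\<lparr>carrier := S\<rparr>))\<lparr>carrier := K_sub K l (M\<lparr>carrier := S\<rparr>) i\<rparr>
      Mod L_sub K l (M\<lparr>carrier := S\<rparr>) i = Y.Layer_quot S i" for i
    by (simp add: K_S L_S FactGroup_def RCOSETS_def r_coset_def set_mult_def)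
  have Q_M: "(add_monoid M)\<lparr>carrier := K_sub K l M i\<rparr> Mod L_sub K l M i = Y.Layer_quot (carrier M) i" for i
    using Y.Ker_Int_carrier[of i] by (simp add: K_M L_M)
  have rho: "rho K l M i = (\<lambda>U. Y.LM i <#>\<^bsub>add_monoid M\<^esub> U)" for i
    by (simp add: rho_def fun_eq_iff L_M set_add_def)
  have R: "R_sub K l M S i = (\<lambda>U. Y.LM i <#>\<^bsub>add_monoid M\<^esub> U) ` carrier (Y.Layer_quot S i)" for i
    unfolding R_sub_def rho carrier_Q_mod Q_S ..
  have fin: "finite (rcosets\<^bsub>add_monoid M\<^esub> S)"
    using assms(5) by (simp add: finite_index_def A_RCOSETS_def)
  have L_eq: "Y.Layer S i = Y.LM i \<inter> S" if i: "i \<in> {1..l}" for i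
  proof (rule Y.Layer_Int_eq[OF fin])
    fix x and n :: nat
    assume x: "x \<in> Y.Ker i \<inter> S" "n > 0" "x [^]\<^bsub>add_monoid M\<^esub> n \<in> Y.Layer S i"
    show "x \<in> Y.Layer S i"
    proof (rule Y.Layer_saturated_if_quot_torsion_free[OF _ x(1,3)])
      fix U assume "U \<in> carrier (Y.Layer_quot S i)" "U [^]\<^bsub>Y.Layer_quot S i\<^esub> n = \<one>\<^bsub>Y.Layer_quot S i\<^esub>"
      moreover have "c = \<zero>\<^bsub>max_order K\<^esub>"
        if "add_pow (max_order K) n c = \<zero>\<^bsub>max_order K\<^esub>" for c
        using that \<open>n > 0\<close> unfolding add_pow_max_order
        by (simp add: max_order_def ring_of_type_algebra_def)
      ultimately show "U = \<one>\<^bsub>Y.Layer_quot S i\<^esub>"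
        using free_module_torsion_free[OF free[OF i], of n U]
        unfolding carrier_Q_mod add_pow_Q_mod zero_Q_mod Q_S by blast
    qed
  qed
  have "L_sub K l (M\<lparr>carrier := S\<rparr>) i = L_sub K l M i \<inter> S
      \<and> rho K l M i \<in> hom (add_monoid (Q_mod K l (M\<lparr>carrier := S\<rparr>) i))
                          (add_monoid (Q_mod K l M i))
      \<and> (\<forall>a \<in> K_sub K l (M\<lparr>carrier := S\<rparr>) i.
            rho K l M i (L_sub K l (M\<lparr>carrier := S\<rparr>) i +>\<^bsub>M\<^esub> a) = L_sub K l M i +>\<^bsub>M\<^esub> a)
      \<and> inj_on (rho K l M i) (carrier (Q_mod K l (M\<lparr>carrier := S\<rparr>) i))
      \<and> finite_index (Q_mod K l M i) (R_sub K l M S i)" if i: "i \<in> {1..l}" for i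
  proof (intro conjI ballI)
    show "L_sub K l (M\<lparr>carrier := S\<rparr>) i = L_sub K l M i \<inter> S"
      using L_eq[OF i] by (simp add: L_S L_M)
    show "rho K l M i \<in> hom (add_monoid (Q_mod K l (M\<lparr>carrier := S\<rparr>) i)) (add_monoid (Q_mod K l M i))"
      unfolding hom_Q_mod Q_S Q_M rho using Y.Layer_mult_hom[of i] by simp
    show "inj_on (rho K l M i) (carrier (Q_mod K l (M\<lparr>carrier := S\<rparr>) i))"
      unfolding carrier_Q_mod Q_S rho using Y.Layer_mult_inj[of i] L_eq[OF i] by simp
    show "finite_index (Q_mod K l M i) (R_sub K l M S i)"
      unfolding finite_index_def a_rcosets_Q_mod Q_M R using Y.finite_rcosets_Layer_quot[OF fin, of i] by simp
    show "rho K l M i (L_sub K l (M\<lparr>carrier := S\<rparr>) i +>\<^bsub>M\<^esub> a) = L_sub K l M i +>\<^bsub>M\<^esub> a"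
      if "a \<in> K_sub K l (M\<lparr>carrier := S\<rparr>) i" for a
      using Y.Layer_mult_coset[of a i] that by (simp add: rho L_S L_M K_S a_r_coset_def)
  qed
  moreover have "index M S = (\<Prod>i=1..l. \<Prod>j=i..l. h j)
      \<and> (\<Prod>i=1..l. \<Prod>j=i..l. h j) = (\<Prod>k=1..l. h k ^ k)"
    if h: "\<forall>i\<in>{1..l}. h i = index (Q_mod K l M i) (R_sub K l M S i)" for h
  proof
    have "h i = Y.layer_index i" if "i \<in> {1..l}" for i
      using h that Y.card_rcosets_Layer_quot[of i] unfolding index_def a_rcosets_Q_mod Q_M R by simp
    then have "(\<Prod>i=1..l. \<Prod>j=i..l. h j) = (\<Prod>i=1..l. \<Prod>j=i..l. Y.layer_index j)"
      by (intro prod.cong refl) auto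
    moreover have "index M S = card (rcosets\<^bsub>add_monoid M\<^esub> S)"
      by (simp add: index_def A_RCOSETS_def)
    ultimately show "index M S = (\<Prod>i=1..l. \<Prod>j=i..l. h j)"
      using Y.index_eq_prod_layer_index[of l] Ker_eq_carrier[OF M S cr] L_eq by simp
    show "(\<Prod>i=1..l. \<Prod>j=i..l. h j) = (\<Prod>k=1..l. h k ^ k)"
      by (rule prod_triangle)
  qed
  ultimately show ?thesis by blast
qed

end
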